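(* There are smooth data $(\Omega,\varphi,\theta)$, with $\Omega\subset\mathbb R^2$ uniformly convex and $0<\theta<\pi/2$, for which a strict lower subsolution of $$F(A[u])=\theta\ \text{ in }\Omega,\qquad u=\varphi\ \text{ on }\partial\Omega$$ exists, but the unique smooth convex solution of this problem is not strictly convex.
   Context: For a function $u$ on $\Omega\subset\mathbb R^2$, $A[u]=\frac1{\sqrt{1+|Du|^2}}B\,D^2u\,B$ with $B=(I+Du\otimes Du)^{-1/2}$, and $F(M)=\sum_i\arctan\lambda_i(M)$; so $F(A[u])$ is the sum of the arctangents of the principal curvatures of the graph of $u$. Convex means $D^2u\ge0$; strictly convex means $D^2u>0$ (positive definite) at every point of $\overline\Omega$. Smooth means smooth up to the boundary. A strict lower subsolution is a smooth strictly convex function $\underline u$ with $\underline u=\varphi$ on $\partial\Omega$ and $F(A[\underline u])>\theta$ on $\overline\Omega$. *)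

theory Defs
  imports "HOL-Analysis.Analysis" "HOL-Computational_Algebra.Polynomial"
begin

text \<open>
  Derivatives are taken within a set \<open>S\<close>, which will be the closure of a bounded convex domain or
  an open interval. On such sets derivatives within \<open>S\<close> are unique, also at boundary points, and
  agree with the ordinary ones in the interior.
\<close>

definition deriv_within ::
  "'a::euclidean_space set \<Rightarrow> 'a \<Rightarrow> ('a \<Rightarrow> real) \<Rightarrow> 'a \<Rightarrow> real" where
  "deriv_within S b f x = frechet_derivative f (at x within S) b"

fun Ck_on :: "nat \<Rightarrow> 'a::euclidean_space set \<Rightarrow> ('a \<Rightarrow> real) \<Rightarrow> bool" where
  "Ck_on 0 S f \<longleftrightarrow> continuous_on S f"
| "Ck_on (Suc k) S f \<longleftrightarrow>
     f differentiable_on S \<and> (\<forall>b\<in>Basis. Ck_on k S (deriv_within S b f))"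

text \<open>
  For \<open>S = closure \<Omega>\<close> with \<open>\<Omega>\<close> open, bounded and convex this is smoothness up to the boundary: all
  partial derivatives exist in \<open>\<Omega>\<close> and extend continuously to \<open>closure \<Omega>\<close>.
\<close>

definition smooth_on :: "'a::euclidean_space set \<Rightarrow> ('a \<Rightarrow> real) \<Rightarrow> bool" where
  "smooth_on S f \<longleftrightarrow> (\<forall>k. Ck_on k S f)"

definition gradient :: "(real^'n) set \<Rightarrow> (real^'n \<Rightarrow> real) \<Rightarrow> real^'n \<Rightarrow> real^'n" where
  "gradient S u x = (\<chi> i. deriv_within S (axis i 1) u x)"

definition hessian :: "(real^'n) set \<Rightarrow> (real^'n \<Rightarrow> real) \<Rightarrow> real^'n \<Rightarrow> real^'n^'n" where
  "hessian S u x = (\<chi> i j. deriv_within S (axis j 1) (deriv_within S (axis i 1) u) x)"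

definition pos_semidef :: "real^'n^'n \<Rightarrow> bool" where
  "pos_semidef M \<longleftrightarrow> transpose M = M \<and> (\<forall>v. 0 \<le> v \<bullet> (M *v v))"

definition pos_def :: "real^'n^'n \<Rightarrow> bool" where
  "pos_def M \<longleftrightarrow> transpose M = M \<and> (\<forall>v. v \<noteq> 0 \<longrightarrow> 0 < v \<bullet> (M *v v))"

definition mat_sqrt :: "real^'n^'n \<Rightarrow> real^'n^'n" where
  "mat_sqrt M = (THE R. pos_semidef R \<and> R ** R = M)"

definition tensor :: "real^'n \<Rightarrow> real^'n \<Rightarrow> real^'n^'n" where
  "tensor p q = (\<chi> i j. p $ i * q $ j)"

definition curvature_matrix :: "(real^'n) set \<Rightarrow> (real^'n \<Rightarrow> real) \<Rightarrow> real^'n \<Rightarrow> real^'n^'n" where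
  "curvature_matrix S u x =
    (let p = gradient S u x;
         B = matrix_inv (mat_sqrt (mat 1 + tensor p p))
     in (1 / sqrt (1 + (norm p)\<^sup>2)) *\<^sub>R (B ** hessian S u x ** B))"

definition charpoly :: "real^'n^'n \<Rightarrow> real poly" where
  "charpoly M = det (\<chi> i j. (if i = j then [:0, 1:] else 0) - [:M $ i $ j:])"

text \<open>
  Sum of the arctangents of the eigenvalues, counted with multiplicity. It is only used for
  symmetric matrices, all of whose eigenvalues are real.
\<close>

definition sum_arctan_eigenvalues :: "real^'n^'n \<Rightarrow> real" where
  "sum_arctan_eigenvalues M =
    (\<Sum>t | poly (charpoly M) t = 0. real (order t (charpoly M)) * arctan t)"

text \<open>
  Near a boundary point \<open>p\<close>, in the orthonormal frame \<open>(e, n)\<close> of tangent and inner normal, the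
  domain is the epigraph of a smooth \<open>g\<close> that vanishes to first order at \<open>0\<close>; hence \<open>g''(0)\<close> is the
  curvature of the boundary at \<open>p\<close> with respect to the inner normal.
\<close>

definition boundary_graph_at ::
  "(real^2) set \<Rightarrow> real^2 \<Rightarrow> real \<Rightarrow> real^2 \<Rightarrow> real^2 \<Rightarrow> (real \<Rightarrow> real) \<Rightarrow> bool" where
  "boundary_graph_at \<Omega> p r e n g \<longleftrightarrow>
     r > 0 \<and> norm e = 1 \<and> norm n = 1 \<and> e \<bullet> n = 0 \<and>
     smooth_on {-r<..<r} g \<and> g 0 = 0 \<and> deriv g 0 = 0 \<and>
     \<Omega> \<inter> ball p r = {x \<in> ball p r. g ((x - p) \<bullet> e) < (x - p) \<bullet> n}"

text \<open>Bounded smooth domains whose boundary curvature has a positive lower bound.\<close>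

definition smooth_uniformly_convex_domain :: "(real^2) set \<Rightarrow> bool" where
  "smooth_uniformly_convex_domain \<Omega> \<longleftrightarrow>
     open \<Omega> \<and> bounded \<Omega> \<and> \<Omega> \<noteq> {} \<and> convex \<Omega> \<and>
     (\<exists>\<kappa>>0. \<forall>p\<in>frontier \<Omega>. \<exists>r e n g.
        boundary_graph_at \<Omega> p r e n g \<and> deriv (deriv g) 0 \<ge> \<kappa>)"

definition hessian_nonneg :: "(real^2) set \<Rightarrow> (real^2 \<Rightarrow> real) \<Rightarrow> bool" where
  "hessian_nonneg \<Omega> u \<longleftrightarrow> (\<forall>x\<in>closure \<Omega>. pos_semidef (hessian (closure \<Omega>) u x))"

definition strictly_convex :: "(real^2) set \<Rightarrow> (real^2 \<Rightarrow> real) \<Rightarrow> bool" where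
  "strictly_convex \<Omega> u \<longleftrightarrow> (\<forall>x\<in>closure \<Omega>. pos_def (hessian (closure \<Omega>) u x))"

definition smooth_convex_solution ::
  "(real^2) set \<Rightarrow> (real^2 \<Rightarrow> real) \<Rightarrow> real \<Rightarrow> (real^2 \<Rightarrow> real) \<Rightarrow> bool" where
  "smooth_convex_solution \<Omega> \<phi> \<theta> u \<longleftrightarrow>
     smooth_on (closure \<Omega>) u \<and> hessian_nonneg \<Omega> u \<and>
     (\<forall>x\<in>\<Omega>. sum_arctan_eigenvalues (curvature_matrix (closure \<Omega>) u x) = \<theta>) \<and>
     (\<forall>x\<in>frontier \<Omega>. u x = \<phi> x)"

definition strict_lower_subsolution ::
  "(real^2) set \<Rightarrow> (real^2 \<Rightarrow> real) \<Rightarrow> real \<Rightarrow> (real^2 \<Rightarrow> real) \<Rightarrow> bool" where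
  "strict_lower_subsolution \<Omega> \<phi> \<theta> v \<longleftrightarrow>
     smooth_on (closure \<Omega>) v \<and> strictly_convex \<Omega> v \<and>
     (\<forall>x\<in>frontier \<Omega>. v x = \<phi> x) \<and>
     (\<forall>x\<in>closure \<Omega>. sum_arctan_eigenvalues (curvature_matrix (closure \<Omega>) v x) > \<theta>)"

end

theory Submission
  imports Defs
begin

text \<open>
  Take the disc of radius 1/4 about the origin, \<open>\<theta> = \<pi>/4\<close> and \<open>u = - sqrt (1 - x\<^sub>1\<^sup>2)\<close>. The graph of
  \<open>u\<close> is part of a unit cylinder, with principal curvatures 1 and 0, so \<open>u\<close> solves the equation
  but is not strictly convex. For \<open>0 < \<epsilon> \<le> 1\<close> the function
  \<open>v\<^sub>\<epsilon> = u + (\<epsilon>/2) (\<bar>x\<bar>\<^sup>2 - 1/16)\<close> is a strict lower subsolution: the disc is so small that the gain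
  in the second derivatives outweighs the change of the gradient.

  For uniqueness, let \<open>w\<close> be a convex solution. At an interior minimum of \<open>w - v\<^sub>\<epsilon>\<close> the gradients agree
  and \<open>D\<^sup>2w \<ge> D\<^sup>2v\<^sub>\<epsilon>\<close>, which contradicts strictness, so \<open>w \<ge> v\<^sub>\<epsilon>\<close>. At an interior
  minimum of \<open>v\<^bsub>-\<epsilon>\<^esub> - w\<close> the second derivative of \<open>w\<close> in direction \<open>x\<^sub>2\<close> would be at most
  \<open>-\<epsilon>\<close>, so \<open>w \<le> v\<^bsub>-\<epsilon>\<^esub>\<close>. Letting \<open>\<epsilon>\<close> tend to 0 gives \<open>w = u\<close>.
\<close>

subsection \<open>Calculus within convex sets\<close>

text \<open>The difference \<open>L\<close> of two derivatives is a derivative of 0, so following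
  the segment from \<open>x\<close> to \<open>y\<close> gives \<open>L (y - x) = 0\<close> for each
  \<open>y\<close> in \<open>S\<close>. A ball inside \<open>S\<close> provides enough such vectors
  for their differences to point in every direction. This covers boundary points and makes
  \<open>deriv_within\<close> computable there.\<close>

lemma has_derivative_within_convex_unique:
  fixes f :: "'a::euclidean_space \<Rightarrow> 'b::real_normed_vector"
  assumes S: "convex S" "interior S \<noteq> {}" and x: "x \<in> S"
    and D: "(f has_derivative D) (at x within S)" "(f has_derivative D') (at x within S)"
  shows "D = D'"
proof -
  define L where "L = (\<lambda>h. D h - D' h)"
  have L: "((\<lambda>_. 0) has_derivative L) (at x within S)"
    using has_derivative_diff[OF D] by (simp add: L_def)
  have lin: "linear L" using L has_derivative_linear by blast
  have zero: "L (y - x) = 0" if "y \<in> S" for y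
  proof -
    have seg: "(\<lambda>t. x + t *\<^sub>R (y - x)) ` {0..1} \<subseteq> S"
    proof (safe)
      fix t :: real assume "t \<in> {0..1}"
      then have "(1 - t) *\<^sub>R x + t *\<^sub>R y \<in> S"
        using S(1) x that by (auto simp: convex_alt)
      then show "x + t *\<^sub>R (y - x) \<in> S" by (simp add: algebra_simps)
    qed
    have "((\<lambda>t. x + t *\<^sub>R (y - x)) has_derivative (\<lambda>t. t *\<^sub>R (y - x))) (at 0 within {0..1})"
      by (auto intro!: derivative_eq_intros)
    moreover have "((\<lambda>_. 0) has_derivative L)
        (at (x + 0 *\<^sub>R (y - x)) within (\<lambda>t. x + t *\<^sub>R (y - x)) ` {0..1})"
      using has_derivative_subset[OF L seg] by simp
    ultimately have "((\<lambda>_. 0) \<circ> (\<lambda>t. x + t *\<^sub>R (y - x)) has_derivative L \<circ> (\<lambda>t. t *\<^sub>R (y - x)))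
        (at 0 within {0..1::real})"
      by (rule diff_chain_within)
    then have 1: "((\<lambda>_. 0) has_vector_derivative L (y - x)) (at 0 within {0..1::real})"
      by (simp add: has_vector_derivative_def o_def linear_cmul[OF lin])
    have 2: "((\<lambda>_. 0) has_vector_derivative 0) (at 0 within {0..1::real})"
      by simp
    show ?thesis
      by (rule vector_derivative_unique_within_closed_interval[of 0 1 0, unfolded cbox_interval,
            OF _ _ 1 2]) auto
  qed
  obtain z d where d: "d > 0" "ball z d \<subseteq> S"
    using S(2) by (meson ex_in_conv mem_interior)
  have "L h = 0" for h
  proof (cases "h = 0")
    case False
    define c where "c = d / (2 * norm h)"
    have c: "c > 0" using False d by (simp add: c_def)
    have "z + c *\<^sub>R h \<in> S" "z \<in> S"
      using d False by (auto simp: subset_iff dist_norm c_def)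
    then have "L (z + c *\<^sub>R h - x) = 0" "L (z - x) = 0" by (auto intro: zero)
    then have "L ((z + c *\<^sub>R h - x) - (z - x)) = 0"
      by (simp only: linear_diff[OF lin]) simp
    then have "L (c *\<^sub>R h) = 0" by (simp add: algebra_simps)
    then show ?thesis using c by (simp add: linear_cmul[OF lin])
  qed (simp add: linear_0[OF lin])
  then show ?thesis by (auto simp: L_def fun_eq_iff)
qed

lemma deriv_within_eqI:
  assumes "convex S" "interior S \<noteq> {}" "x \<in> S" "(f has_derivative D) (at x within S)"
  shows "deriv_within S b f x = D b"
proof -
  have "(f has_derivative frechet_derivative f (at x within S)) (at x within S)"
    using assms(4) frechet_derivative_works differentiableI by blast
  then show ?thesis
    unfolding deriv_within_def using has_derivative_within_convex_unique assms by metis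
qed

text \<open>For second derivatives: a closed form of the first derivative that holds only on
  \<open>S\<close> may be substituted before differentiating again.\<close>

lemma deriv_within_cong:
  assumes "\<And>y. y \<in> S \<Longrightarrow> f y = g y" "x \<in> S"
  shows "deriv_within S b f x = deriv_within S b g x"
proof -
  have "(f has_derivative D) (at x within S) \<longleftrightarrow> (g has_derivative D) (at x within S)" for D
    using has_derivative_transform[OF assms(2)] assms(1) by metis
  then show ?thesis by (simp add: deriv_within_def frechet_derivative_def)
qed

section \<open>Closure properties of k-fold differentiability\<close>

lemma Ck_on_cong:
  assumes "\<And>y. y \<in> S \<Longrightarrow> f y = g y" "Ck_on k S f"
  shows "Ck_on k S g"
  using assms
proof (induction k arbitrary: f g)
  case 0
  then show ?case by (simp cong: continuous_on_cong)
next
  case (Suc k)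
  have "g differentiable (at x within S)" if x: "x \<in> S" for x
  proof -
    obtain D where "(f has_derivative D) (at x within S)"
      using Suc.prems(2) x by (auto simp: differentiable_on_def differentiable_def)
    then have "(g has_derivative D) (at x within S)"
      using has_derivative_transform[OF x] Suc.prems(1) by metis
    then show ?thesis by (rule differentiableI)
  qed
  moreover have "Ck_on k S (deriv_within S b g)" if "b \<in> Basis" for b
  proof (rule Suc.IH)
    show "deriv_within S b f y = deriv_within S b g y" if "y \<in> S" for y
      by (rule deriv_within_cong[OF Suc.prems(1) that])
    show "Ck_on k S (deriv_within S b f)" using Suc.prems(2) that by simp
  qed
  ultimately show ?case by (simp add: differentiable_on_def)
qed

lemma Ck_on_SucD: "Ck_on (Suc k) S f \<Longrightarrow> Ck_on k S f"
  by (induction k arbitrary: f) (auto intro: differentiable_imp_continuous_on)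

context
  fixes S :: "'a::euclidean_space set"
  assumes S: "convex S" "interior S \<noteq> {}"
begin

text \<open>The inductive step behind the smoothness proofs: any exhibited derivative yields the
  partial derivatives by uniqueness, so only the smoothness of its values on basis vectors is
  left.\<close>

lemma Ck_on_SucI:
  assumes "\<And>x. x \<in> S \<Longrightarrow> (f has_derivative f' x) (at x within S)"
    and "\<And>b. b \<in> Basis \<Longrightarrow> Ck_on k S (\<lambda>x. f' x b)"
  shows "Ck_on (Suc k) S f"
proof -
  have "Ck_on k S (deriv_within S b f)" if "b \<in> Basis" for b
    by (rule Ck_on_cong[OF _ assms(2)[OF that]]) (simp add: deriv_within_eqI[OF S _ assms(1)])
  then show ?thesis
    using assms(1) by (auto simp: differentiable_on_def differentiable_def)
qed

lemma Ck_on_has_derivative: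
  assumes "Ck_on (Suc k) S f" "x \<in> S"
  shows "(f has_derivative (\<lambda>b. deriv_within S b f x)) (at x within S)"
  using assms unfolding deriv_within_def by (simp add: differentiable_on_def frechet_derivative_works)

lemma Ck_on_const: "Ck_on k S (\<lambda>_. c)"
proof (induction k arbitrary: c)
  case (Suc k)
  show ?case by (rule Ck_on_SucI[where f' = "\<lambda>_ _. 0"]) (auto intro: Suc)
qed simp

lemma Ck_on_bounded_linear: "bounded_linear f \<Longrightarrow> Ck_on k S f"
proof (cases k)
  case (Suc m)
  assume "bounded_linear f"
  then show ?thesis unfolding Suc
    by (intro Ck_on_SucI[where f' = "\<lambda>_. f"] bounded_linear_imp_has_derivative Ck_on_const)
qed (simp add: linear_continuous_on)

lemma Ck_on_add:
  assumes "Ck_on k S f" "Ck_on k S g"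
  shows "Ck_on k S (\<lambda>x. f x + g x)"
  using assms
proof (induction k arbitrary: f g)
  case (Suc k)
  show ?case
    by (rule Ck_on_SucI[OF has_derivative_add[OF Ck_on_has_derivative[OF Suc.prems(1)]
          Ck_on_has_derivative[OF Suc.prems(2)]]])
      (use Suc in auto)
qed (auto intro: continuous_intros)

lemma Ck_on_mult:
  assumes "Ck_on k S f" "Ck_on k S g"
  shows "Ck_on k S (\<lambda>x. f x * g x)"
  using assms
proof (induction k arbitrary: f g)
  case (Suc k)
  show ?case
    by (rule Ck_on_SucI[OF has_derivative_mult[OF Ck_on_has_derivative[OF Suc.prems(1)]
          Ck_on_has_derivative[OF Suc.prems(2)]]])
      (use Suc in \<open>auto intro!: Ck_on_add Suc.IH intro: Ck_on_SucD\<close>)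
qed (auto intro: continuous_intros)

lemma Ck_on_minus: "Ck_on k S f \<Longrightarrow> Ck_on k S (\<lambda>x. - f x)"
  using Ck_on_mult[OF Ck_on_const[of k "-1"]] by simp

lemma Ck_on_diff: "Ck_on k S f \<Longrightarrow> Ck_on k S g \<Longrightarrow> Ck_on k S (\<lambda>x. f x - g x)"
  using Ck_on_add[of k f "\<lambda>x. - g x"] Ck_on_minus[of k g] by simp

lemma Ck_on_power: "Ck_on k S f \<Longrightarrow> Ck_on k S (\<lambda>x. f x ^ n)"
  by (induction n) (auto intro: Ck_on_const Ck_on_mult)

text \<open>For fixed \<open>h\<close> the derivative is a polynomial in \<open>l\<close> and in the
  function itself. Hence smoothness of the reciprocal root follows by induction on the order, which
  is why it is treated before the root.\<close>

lemma has_derivative_inverse_sqrt_diff_squares: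
  fixes l :: "'a \<Rightarrow> real"
  assumes l: "bounded_linear l" and "(l x)\<^sup>2 < R\<^sup>2"
  shows "((\<lambda>x. inverse (sqrt (R\<^sup>2 - (l x)\<^sup>2))) has_derivative
      (\<lambda>h. l x * l h * inverse (sqrt (R\<^sup>2 - (l x)\<^sup>2)) ^ 3)) (at x within S)"
  using assms(2)
  by (auto intro!: derivative_eq_intros bounded_linear_imp_has_derivative[OF l]
      simp: fun_eq_iff field_simps power3_eq_cube power2_eq_square)

lemma Ck_on_inverse_sqrt_diff_squares:
  fixes l :: "'a \<Rightarrow> real"
  assumes l: "bounded_linear l" and less: "\<And>x. x \<in> S \<Longrightarrow> (l x)\<^sup>2 < R\<^sup>2"
  shows "Ck_on k S (\<lambda>x. inverse (sqrt (R\<^sup>2 - (l x)\<^sup>2)))"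
proof (induction k)
  case 0
  then show ?case
    by (auto intro!: continuous_intros linear_continuous_on[OF l] dest: less)
next
  case (Suc k)
  show ?case
    by (rule Ck_on_SucI[OF has_derivative_inverse_sqrt_diff_squares[OF l less]])
      (assumption, intro Ck_on_mult Ck_on_power Ck_on_const Ck_on_bounded_linear[OF l] Suc)
qed

text \<open>Reduction to the reciprocal root through \<open>sqrt y = y * inverse (sqrt y)\<close>
  for positive \<open>y\<close>.\<close>

lemma Ck_on_sqrt_diff_squares:
  fixes l :: "'a \<Rightarrow> real"
  assumes l: "bounded_linear l" and less: "\<And>x. x \<in> S \<Longrightarrow> (l x)\<^sup>2 < R\<^sup>2"
  shows "Ck_on k S (\<lambda>x. sqrt (R\<^sup>2 - (l x)\<^sup>2))"
proof (rule Ck_on_cong)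
  show "Ck_on k S (\<lambda>x. (R\<^sup>2 - (l x)\<^sup>2) * inverse (sqrt (R\<^sup>2 - (l x)\<^sup>2)))"
    by (intro Ck_on_mult Ck_on_diff Ck_on_const Ck_on_power Ck_on_bounded_linear[OF l]
        Ck_on_inverse_sqrt_diff_squares[OF l less])
  show "(R\<^sup>2 - (l x)\<^sup>2) * inverse (sqrt (R\<^sup>2 - (l x)\<^sup>2)) = sqrt (R\<^sup>2 - (l x)\<^sup>2)" if "x \<in> S" for x
    using less[OF that] by (simp add: field_simps)
qed

end


section \<open>First- and second-order conditions at an interior minimum\<close>

text \<open>If \<open>l\<close> were negative, \<open>h'\<close> would be negative just to the right
  of its zero at 0, and \<open>h\<close> would drop below \<open>h 0\<close>.\<close>

lemma DERIV2_nonneg_at_local_min: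
  fixes h h' :: "real \<Rightarrow> real"
  assumes d: "d > 0" and min: "\<And>t. \<bar>t\<bar> < d \<Longrightarrow> h 0 \<le> h t"
    and h: "\<And>t. \<bar>t\<bar> < d \<Longrightarrow> (h has_real_derivative h' t) (at t)"
    and h': "(h' has_real_derivative l) (at 0)"
  shows "h' 0 = 0" "0 \<le> l"
proof -
  show h'0: "h' 0 = 0"
    by (rule DERIV_local_min[OF h[of 0] d]) (use d min in auto)
  show "0 \<le> l"
  proof (rule ccontr)
    assume "\<not> 0 \<le> l"
    then obtain e where e: "e > 0" "\<And>s. 0 < s \<Longrightarrow> s < e \<Longrightarrow> h' s < 0"
      using DERIV_neg_dec_right[OF h'] h'0 by auto
    define t where "t = min d e / 2"
    have t: "0 < t" "t < d" "t < e" using d e(1) by (auto simp: t_def min_def)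
    have "h 0 > h t"
    proof (rule DERIV_neg_imp_decreasing_open[of 0 t h])
      show "\<exists>y. DERIV h x :> y \<and> y < 0" if "0 < x" "x < t" for x
        using h[of x] e(2)[of x] that t by auto
      show "continuous_on {0..t} h"
        using h t by (intro DERIV_continuous_on[of _ _ h'])
          (auto intro: has_field_derivative_at_within)
    qed (use t in auto)
    then show False using min[of t] t by simp
  qed
qed

text \<open>At an interior point the derivative within \<open>S\<close> is the ordinary one, so the
  chain rule applies along the line. It is applied to a function and then to its partial
  derivatives.\<close>

lemma deriv_within_line:
  fixes f :: "'a::euclidean_space \<Rightarrow> real"
  assumes f: "f differentiable_on S" and x: "x + t *\<^sub>R v \<in> interior S"
  shows "((\<lambda>t. f (x + t *\<^sub>R v)) has_real_derivative
    (\<Sum>b\<in>Basis. (v \<bullet> b) * deriv_within S b f (x + t *\<^sub>R v))) (at t)"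
proof -
  let ?D = "frechet_derivative f (at (x + t *\<^sub>R v) within S)"
  have D: "(f has_derivative ?D) (at (x + t *\<^sub>R v) within S)"
    using f subsetD[OF interior_subset x] unfolding differentiable_on_def frechet_derivative_works
    by blast
  have "((\<lambda>t. x + t *\<^sub>R v) has_derivative (\<lambda>s. s *\<^sub>R v)) (at t)"
    by (auto intro!: derivative_eq_intros)
  then have "((\<lambda>t. f (x + t *\<^sub>R v)) has_derivative (\<lambda>s. ?D (s *\<^sub>R v))) (at t)"
    by (rule has_derivative_compose) (use D in \<open>simp only: at_within_interior[OF x]\<close>)
  moreover have "?D (s *\<^sub>R v) = (\<Sum>b\<in>Basis. (v \<bullet> b) * ?D b) * s" for s
  proof -
    have lin: "linear ?D" using D has_derivative_linear by blast
    have "?D v = ?D (\<Sum>b\<in>Basis. (v \<bullet> b) *\<^sub>R b)" by (simp add: euclidean_representation)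
    also have "\<dots> = (\<Sum>b\<in>Basis. (v \<bullet> b) * ?D b)"
      by (simp add: linear_sum[OF lin] linear_cmul[OF lin])
    finally show ?thesis by (simp add: linear_cmul[OF lin])
  qed
  ultimately show ?thesis
    by (simp add: has_field_derivative_def deriv_within_def)
qed

lemma sum_Basis_real_cart:
  fixes f :: "real^'n \<Rightarrow> 'b::comm_monoid_add"
  shows "(\<Sum>b\<in>Basis. f b) = (\<Sum>i\<in>UNIV. f (axis i 1))"
proof -
  have Basis: "Basis = (\<lambda>i::'n. axis i (1::real)) ` UNIV"
    by (auto simp: Basis_vec_def)
  have inj: "inj (\<lambda>i::'n. axis i (1::real))"
    by (auto simp: inj_def axis_eq_axis)
  show ?thesis unfolding Basis by (subst sum.reindex[OF inj]) (simp add: o_def)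
qed

text \<open>Restricting \<open>f - g\<close> to each line through \<open>x\<close> reduces both
  claims to the one-variable conditions.\<close>

lemma local_min_gradient_hessian:
  fixes f :: "real^'n \<Rightarrow> real"
  assumes f: "Ck_on 2 S f" "Ck_on 2 S g" and x: "x \<in> interior S"
    and min: "\<And>y. y \<in> S \<Longrightarrow> f x - g x \<le> f y - g y"
  shows "gradient S f x = gradient S g x"
    and "0 \<le> v \<bullet> ((hessian S f x - hessian S g x) *v v)"
proof -
  \<comment> \<open>\<open>Df\<close> and \<open>Dg\<close> are the first directional derivatives
    along \<open>v\<close>; \<open>l\<close> is the second one at \<open>x\<close>, written so as to
    match the quadratic form of \<open>hessian\<close>.\<close>
  define Df where "Df v y = (\<Sum>b\<in>Basis. (v \<bullet> b) * deriv_within S b f y)" for v y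
  define Dg where "Dg v y = (\<Sum>b\<in>Basis. (v \<bullet> b) * deriv_within S b g y)" for v y
  define l where "l u v = (\<Sum>b\<in>Basis. (v \<bullet> b) * (\<Sum>c\<in>Basis. (v \<bullet> c) * deriv_within S c (deriv_within S b u) x))"
    for u v
  have Df0: "Df v x - Dg v x = 0" and l0: "0 \<le> l f v - l g v" for v
  proof -
    obtain r where r: "r > 0" "ball x r \<subseteq> S"
      using x by (meson mem_interior)
    \<comment> \<open>Chosen so that \<open>x + t *\<^sub>R v\<close> stays in the ball for
      \<open>\<bar>t\<bar> < d\<close>; the added 1 also admits \<open>v = 0\<close>.\<close>
    define d where "d = r / (norm v + 1)"
    have nv: "norm v + 1 > 0" by (smt (verit) norm_ge_zero)
    have d: "d > 0" using r nv by (simp add: d_def)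
    have inS: "x + t *\<^sub>R v \<in> ball x r" if "\<bar>t\<bar> < d" for t
    proof -
      have "\<bar>t\<bar> * norm v \<le> \<bar>t\<bar> * (norm v + 1)" by (simp add: mult_left_mono)
      also have "\<dots> < r" using that nv by (simp add: d_def field_simps)
      finally show ?thesis by (simp add: dist_norm)
    qed
    have int: "x + t *\<^sub>R v \<in> interior S" if "\<bar>t\<bar> < d" for t
      using inS[OF that] r(2) by (meson interior_maximal open_ball subsetD)
    have diff: "f differentiable_on S" "g differentiable_on S"
      using f by (auto simp: numeral_2_eq_2)
    have diff2: "deriv_within S b f differentiable_on S" "deriv_within S b g differentiable_on S"
      if "b \<in> Basis" for b
      using f that by (auto simp: numeral_2_eq_2)
    have h: "((\<lambda>t. f (x + t *\<^sub>R v) - g (x + t *\<^sub>R v)) has_real_derivative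
        (Df v (x + t *\<^sub>R v) - Dg v (x + t *\<^sub>R v))) (at t)" if "\<bar>t\<bar> < d" for t
      unfolding Df_def Dg_def by (intro DERIV_diff deriv_within_line diff int that)
    have "((\<lambda>t. Df v (x + t *\<^sub>R v) - Dg v (x + t *\<^sub>R v)) has_real_derivative
        (\<Sum>b\<in>Basis. (v \<bullet> b) * (\<Sum>c\<in>Basis. (v \<bullet> c) * deriv_within S c (deriv_within S b f) (x + 0 *\<^sub>R v))) -
        (\<Sum>b\<in>Basis. (v \<bullet> b) * (\<Sum>c\<in>Basis. (v \<bullet> c) * deriv_within S c (deriv_within S b g) (x + 0 *\<^sub>R v)))) (at 0)"
      unfolding Df_def Dg_def
      by (intro DERIV_diff DERIV_sum DERIV_cmult deriv_within_line diff2 int) (use d in auto)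
    then have h': "((\<lambda>t. Df v (x + t *\<^sub>R v) - Dg v (x + t *\<^sub>R v)) has_real_derivative l f v - l g v) (at 0)"
      by (simp add: l_def)
    have "f (x + 0 *\<^sub>R v) - g (x + 0 *\<^sub>R v) \<le> f (x + t *\<^sub>R v) - g (x + t *\<^sub>R v)"
      if "\<bar>t\<bar> < d" for t using min inS[OF that] r(2) by auto
    from DERIV2_nonneg_at_local_min[OF d this h h']
    show "Df v x - Dg v x = 0" "0 \<le> l f v - l g v" by simp_all
  qed
  have "(\<Sum>b\<in>Basis. (axis i 1 \<bullet> b) * deriv_within S b u x) = gradient S u x $ i" for u i
    by (simp add: gradient_def sum_Basis_real_cart inner_axis_axis if_distrib[of "\<lambda>c. c * _"] cong: if_cong)
  then show "gradient S f x = gradient S g x"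
    using Df0[of "axis _ 1"] by (simp add: Df_def Dg_def vec_eq_iff)
  have "l u v = v \<bullet> (hessian S u x *v v)" for u
    unfolding inner_vec_def[of v "_ *v _"]
    by (simp add: l_def hessian_def sum_Basis_real_cart matrix_vector_mult_def inner_axis mult.commute)
  then show "0 \<le> v \<bullet> ((hessian S f x - hessian S g x) *v v)"
    using l0[of v] by (simp add: matrix_vector_mult_diff_rdistrib inner_diff_right)
qed

subsection \<open>Two-by-two matrices and the curvature operator\<close>

lemma matrix2_eq_iff:
  "(A::real^2^2) = B \<longleftrightarrow> A$1$1 = B$1$1 \<and> A$1$2 = B$1$2 \<and> A$2$1 = B$2$1 \<and> A$2$2 = B$2$2"
  by (auto simp: vec_eq_iff forall_2)

lemma matrix2_mult_nth: "((A::real^2^2) ** B) $ i $ j = A$i$1 * B$1$j + A$i$2 * B$2$j"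
  by (simp add: matrix_matrix_mult_def sum_2)

lemma inner_matrix2_vector:
  "(v::real^2) \<bullet> (A *v v) = A$1$1 * (v$1)\<^sup>2 + (A$1$2 + A$2$1) * v$1 * v$2 + A$2$2 * (v$2)\<^sup>2"
  by (simp add: inner_vec_def matrix_vector_mult_def sum_2 algebra_simps power2_eq_square)

lemma symmetric2_iff: "transpose (A::real^2^2) = A \<longleftrightarrow> A$1$2 = A$2$1"
  by (auto simp: vec_eq_iff forall_2 transpose_def)

lemma binary_form_nonneg_iff:
  fixes a b c :: real
  shows "(\<forall>x y. 0 \<le> a * x\<^sup>2 + 2 * b * x * y + c * y\<^sup>2) \<longleftrightarrow> 0 \<le> a \<and> 0 \<le> c \<and> b\<^sup>2 \<le> a * c"
proof safe
  assume *: "\<forall>x y. 0 \<le> a * x\<^sup>2 + 2 * b * x * y + c * y\<^sup>2"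
  show a: "0 \<le> a" and c: "0 \<le> c" using *[rule_format, of 1 0] *[rule_format, of 0 1] by simp_all
  show "b\<^sup>2 \<le> a * c"
  proof (cases "a = 0")
    case True
    have "b = 0"
    proof (rule ccontr)
      assume "b \<noteq> 0"
      \<comment> \<open>With \<open>a = 0\<close> the form takes the value -1 at this point.\<close>
      then show False
        using *[rule_format, of "- (c + 1) / (2 * b)" 1] True by (simp add: field_simps)
    qed
    then show ?thesis using a c by simp
  next
    case False
    have "a * (b\<^sup>2) \<le> a * (a * c)"
      \<comment> \<open>At \<open>(-b, a)\<close> the form equals \<open>a\<close> times the
        quantity \<open>a * c\<close> minus the square of \<open>b\<close>.\<close>
      using *[rule_format, of "- b" a] by (simp add: algebra_simps power2_eq_square)
    then show ?thesis using False a by simp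
  qed
next
  fix x y assume a: "0 \<le> a" and c: "0 \<le> c" and b: "b\<^sup>2 \<le> a * c"
  show "0 \<le> a * x\<^sup>2 + 2 * b * x * y + c * y\<^sup>2"
  proof (cases "a = 0")
    case True
    then show ?thesis using b c by simp
  next
    case False
    have "0 \<le> (a * x + b * y)\<^sup>2 + (a * c - b\<^sup>2) * y\<^sup>2" using b by simp
    also have "\<dots> = a * (a * x\<^sup>2 + 2 * b * x * y + c * y\<^sup>2)"
      by (simp add: algebra_simps power2_eq_square)
    finally show ?thesis using a False by (simp add: zero_le_mult_iff)
  qed
qed

lemma pos_semidef2_iff:
  fixes A :: "real^2^2"
  shows "pos_semidef A \<longleftrightarrow>
    A$1$2 = A$2$1 \<and> 0 \<le> A$1$1 \<and> 0 \<le> A$2$2 \<and> (A$1$2)\<^sup>2 \<le> A$1$1 * A$2$2"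
proof -
  have "(\<forall>v. 0 \<le> v \<bullet> (A *v v)) \<longleftrightarrow>
      (\<forall>x y. 0 \<le> A$1$1 * x\<^sup>2 + 2 * A$1$2 * x * y + A$2$2 * y\<^sup>2)" (is "?l = ?r") if "A$1$2 = A$2$1"

  proof
    show ?r if ?l
    proof (intro allI)
      fix x y show "0 \<le> A$1$1 * x\<^sup>2 + 2 * A$1$2 * x * y + A$2$2 * y\<^sup>2"
        using that[rule_format, of "vector [x, y]"] \<open>A$1$2 = A$2$1\<close> by (simp add: inner_matrix2_vector)
    qed
    show ?l if ?r
      using that \<open>A$1$2 = A$2$1\<close> by (simp add: inner_matrix2_vector)
  qed
  then show ?thesis
    unfolding pos_semidef_def symmetric2_iff using binary_form_nonneg_iff by blast
qed

text \<open>By Cayley--Hamilton, \<open>R\<close> is determined by \<open>R ** R\<close> together with its trace and determinant,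
  and both are recovered from those of \<open>R ** R\<close>.\<close>

lemma pos_semidef_sqrt_unique:
  fixes R Q :: "real^2^2"
  assumes R: "pos_semidef R" and Q: "pos_semidef Q" and eq: "R ** R = Q ** Q"
    and pos: "0 < R$1$1 + R$2$2"
  shows "R = Q"
proof -
  define a b d a' b' d' where "a = R$1$1" "b = R$1$2" "d = R$2$2" "a' = Q$1$1" "b' = Q$1$2" "d' = Q$2$2"
  note defs = this
  have R': "R$2$1 = b" "0 \<le> a" "0 \<le> d" "b\<^sup>2 \<le> a * d" and Q': "Q$2$1 = b'" "0 \<le> a'" "0 \<le> d'" "b'\<^sup>2 \<le> a' * d'"
    using R Q by (auto simp: pos_semidef2_iff defs)
  have e: "a * a + b * b = a' * a' + b' * b'" "a * b + b * d = a' * b' + b' * d'" "b * b + d * d = b' * b' + d' * d'"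
    using eq R' Q' by (simp_all add: matrix2_eq_iff matrix2_mult_nth defs)
  have "(a * d - b\<^sup>2)\<^sup>2 = (a * a + b * b) * (b * b + d * d) - (a * b + b * d)\<^sup>2"
    by (simp add: power2_eq_square algebra_simps)
  also have "\<dots> = (a' * d' - b'\<^sup>2)\<^sup>2"
    unfolding e by (simp add: power2_eq_square algebra_simps)
  finally have det: "a * d - b\<^sup>2 = a' * d' - b'\<^sup>2"
    using R' Q' by (simp add: power2_eq_iff_nonneg)
  have "(a + d)\<^sup>2 = (a * a + b * b) + (b * b + d * d) + 2 * (a * d - b\<^sup>2)"
    by (simp add: power2_eq_square algebra_simps)
  also have "\<dots> = (a' + d')\<^sup>2"
    unfolding e det by (simp add: power2_eq_square algebra_simps)
  finally have tr: "a + d = a' + d'"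
    using R' Q' by (simp add: power2_eq_iff_nonneg)
  have "a * (a + d) = (a * a + b * b) + (a * d - b\<^sup>2)" by (simp add: power2_eq_square algebra_simps)
  also have "\<dots> = a' * (a + d)" unfolding e det tr by (simp add: power2_eq_square algebra_simps)
  finally have "a = a'" using pos by (simp add: defs)
  moreover have "b * (a + d) = b' * (a' + d')" using e(2) by (simp add: algebra_simps)
  then have "b = b'" using pos tr by (simp add: defs)
  ultimately show ?thesis using tr R' Q' by (simp add: matrix2_eq_iff defs)
qed

section \<open>Square root and inverse of rank-one perturbations of the identity\<close>

lemma mat_sqrt_eqI:
  fixes R :: "real^2^2"
  assumes "pos_semidef R" "0 < R$1$1 + R$2$2"
  shows "mat_sqrt (R ** R) = R"
  unfolding mat_sqrt_def
proof (rule the_equality)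
  show "Q = R" if "pos_semidef Q \<and> Q ** Q = R ** R" for Q
    using that by (intro pos_semidef_sqrt_unique[OF assms(1) _ _ assms(2), symmetric]) simp_all
qed (simp add: assms)

lemma matrix_inv_eqI:
  fixes A B :: "real^'n^'n"
  assumes "A ** B = mat 1"
  shows "matrix_inv A = B"
proof -
  have BA: "B ** A = mat 1" using assms matrix_left_right_inverse by blast
  have "A ** matrix_inv A = mat 1 \<and> matrix_inv A ** A = mat 1"
    unfolding matrix_inv_def by (rule someI_ex) (use assms BA in blast)
  then have "B ** (A ** matrix_inv A) = B" by simp
  then show ?thesis by (simp add: matrix_mul_assoc BA)
qed

text \<open>Orthogonally to \<open>p\<close> all matrices involved act as the identity. Along
  \<open>p\<close>, \<open>mat 1 + tensor p p\<close> has eigenvalue \<open>W * W\<close>, so its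
  root \<open>R\<close> has eigenvalue \<open>W\<close> and the inverse of \<open>R\<close> has
  \<open>1 / W\<close>; this dictates the coefficients of \<open>tensor p p\<close>.\<close>

lemma matrix_inv_mat_sqrt_tensor:
  fixes p :: "real^2"
  defines "W \<equiv> sqrt (1 + (norm p)\<^sup>2)"
  shows "matrix_inv (mat_sqrt (mat 1 + tensor p p)) = mat 1 - (1 / (W * (1 + W))) *\<^sub>R tensor p p"
proof -
  have n: "(norm p)\<^sup>2 = (p$1)\<^sup>2 + (p$2)\<^sup>2"
    unfolding power2_norm_eq_inner by (simp add: inner_vec_def sum_2 power2_eq_square)
  have W2: "W\<^sup>2 = 1 + (p$1)\<^sup>2 + (p$2)\<^sup>2" and W: "W > 0" "W \<noteq> 0" "1 + W \<noteq> 0"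
    unfolding W_def n by (auto simp: add_nonneg_eq_0_iff add_pos_nonneg add_nonneg_pos)
  define c where "c = 1 / (1 + W)"
  define R where "R = mat 1 + c *\<^sub>R tensor p p"
  have c: "c > 0" "c * (1 + W) = 1" using W by (simp_all add: c_def)
  have nth: "R$1$1 = 1 + c * (p$1)\<^sup>2" "R$2$2 = 1 + c * (p$2)\<^sup>2" "R$1$2 = c * p$1 * p$2" "R$2$1 = c * p$1 * p$2"
    by (simp_all add: R_def mat_def tensor_def power2_eq_square)
  have "(c * p$1 * p$2)\<^sup>2 = (c * (p$1)\<^sup>2) * (c * (p$2)\<^sup>2)"
    by (simp add: power2_eq_square algebra_simps)
  also have "\<dots> \<le> (1 + c * (p$1)\<^sup>2) * (1 + c * (p$2)\<^sup>2)"
    using c by (intro mult_mono) auto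
  finally have psd: "pos_semidef R"
    unfolding pos_semidef2_iff nth using c by simp
  have tr: "0 < R$1$1 + R$2$2" unfolding nth using c by (simp add: add_pos_nonneg)
  \<comment> \<open>The left side is the coefficient of \<open>tensor p p\<close> in
    \<open>R ** R\<close>.\<close>
  have c2: "2 * c + c\<^sup>2 * ((p$1)\<^sup>2 + (p$2)\<^sup>2) = 1"
  proof -
    have pq: "(p$1)\<^sup>2 + (p$2)\<^sup>2 = (W - 1) * (1 + W)"
      using W2 by (simp add: algebra_simps power2_eq_square)
    have "c\<^sup>2 * ((p$1)\<^sup>2 + (p$2)\<^sup>2) = c * (W - 1) * (c * (1 + W))"
      unfolding pq by (simp add: power2_eq_square)
    also have "\<dots> = c * (W - 1)" unfolding c by simp
    finally show ?thesis using c by (simp add: algebra_simps)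
  qed
  have "R ** R = mat 1 + tensor p p"
  proof -
    have *: "2 * c * z + c\<^sup>2 * ((p$1)\<^sup>2 + (p$2)\<^sup>2) * z = z" for z
      using arg_cong[OF c2, of "\<lambda>y. y * z"] by (simp only: distrib_right mult_1)
    show ?thesis
      unfolding matrix2_eq_iff matrix2_mult_nth nth
      using *[of "(p$1)\<^sup>2"] *[of "p$1 * p$2"] *[of "(p$2)\<^sup>2"]
      by (simp add: mat_def tensor_def) (simp add: algebra_simps power2_eq_square)
  qed
  then have "mat_sqrt (mat 1 + tensor p p) = R"
    using mat_sqrt_eqI[OF psd tr] by simp
  moreover have "matrix_inv R = mat 1 - (c / W) *\<^sub>R tensor p p"
  proof (rule matrix_inv_eqI)
    \<comment> \<open>The coefficient of \<open>tensor p p\<close> in the product of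
      \<open>R\<close> with its claimed inverse.\<close>
    have "c - c / W - c * (c / W) * ((p$1)\<^sup>2 + (p$2)\<^sup>2) = 0"
    proof -
      have "c - c / W - c * (c / W) * ((p$1)\<^sup>2 + (p$2)\<^sup>2) = (c / W) * (W - 1 - c * (W\<^sup>2 - 1))"
        using W W2 by (simp add: field_simps)
      also have "W - 1 - c * (W\<^sup>2 - 1) = (W - 1) * (1 - c * (1 + W))"
        by (simp add: algebra_simps power2_eq_square)
      finally show ?thesis using c by simp
    qed
    \<comment> \<open>Naming the quotient \<open>k\<close> removes the division: the four entries
      become polynomial consequences of one identity, which \<open>algebra\<close> can
      settle.\<close>
    then obtain k where k: "k = c / W" "c - k - c * k * ((p$1)\<^sup>2 + (p$2)\<^sup>2) = 0" by blast
    have "(1 + c * (p$1)\<^sup>2) * (1 - k * (p$1)\<^sup>2) + c * p$1 * p$2 * - (k * p$1 * p$2) = 1"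
      "(1 + c * (p$1)\<^sup>2) * - (k * p$1 * p$2) + c * p$1 * p$2 * (1 - k * (p$2)\<^sup>2) = 0"
      "c * p$1 * p$2 * (1 - k * (p$1)\<^sup>2) + (1 + c * (p$2)\<^sup>2) * - (k * p$1 * p$2) = 0"
      "c * p$1 * p$2 * - (k * p$1 * p$2) + (1 + c * (p$2)\<^sup>2) * (1 - k * (p$2)\<^sup>2) = 1"
      using k(2) by algebra+
    then show "R ** (mat 1 - (c / W) *\<^sub>R tensor p p) = mat 1"
      unfolding matrix2_eq_iff matrix2_mult_nth nth k(1)[symmetric]
      by (simp add: mat_def tensor_def power2_eq_square mult_ac)
  qed
  ultimately show ?thesis by (simp add: c_def mult.commute)
qed

section \<open>Eigenvalues and sums of arctangents\<close>

lemma charpoly2: "charpoly (A::real^2^2) = [:det A, - (A$1$1 + A$2$2), 1:]"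
  by (simp add: charpoly_def det_2)

text \<open>The characteristic polynomial splits with roots \<open>s\<close> and \<open>t\<close>.
  For \<open>s = t\<close> the root set has one element, and its order 2 restores the second
  summand.\<close>

lemma sum_arctan_eigenvalues2:
  fixes A :: "real^2^2"
  assumes tr: "A$1$1 + A$2$2 = s + t" and det: "det A = s * t"
  shows "sum_arctan_eigenvalues A = arctan s + arctan t"
proof -
  have cp: "charpoly A = [:- s, 1:] * [:- t, 1:]"
    by (simp add: charpoly2 tr det)
  have ord: "order x (charpoly A) = (if x = s then 1 else 0) + (if x = t then 1 else 0)" for x
    unfolding cp using order_power_n_n[of _ 1] by (subst order_mult) (auto simp: order_0I)
  have roots: "{x. poly (charpoly A) x = 0} = {s, t}"
    unfolding cp poly_mult by auto
  show ?thesis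
    unfolding sum_arctan_eigenvalues_def roots ord by (cases "s = t") auto
qed

text \<open>Moving \<open>arctan t\<close> to the other side and using the subtraction formula for
  the tangent gives the denominator \<open>1 + t\<close>, which is positive; the addition formula
  would require cases on the sign of \<open>1 - s * t\<close>.\<close>

lemma arctan_add_nonneg_compare:
  fixes s t :: real
  assumes "0 \<le> s" "0 \<le> t"
  shows "pi / 4 < arctan s + arctan t \<longleftrightarrow> 1 < s + t + s * t"
    and "arctan s + arctan t = pi / 4 \<longleftrightarrow> s + t + s * t = 1"
proof -
  have *: "pi / 4 - arctan t = arctan ((1 - t) / (1 + t))"
  proof (rule arctan_unique[symmetric])
    have "0 \<le> arctan t" "arctan t < pi / 2" using assms arctan_ubound by auto
    then show "- (pi / 2) < pi / 4 - arctan t" "pi / 4 - arctan t < pi / 2" using pi_gt_zero by linarith+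
    have "cos (arctan t) \<noteq> 0" by simp
    moreover have "cos (pi / 4 - arctan t) \<noteq> 0"
      using \<open>- (pi / 2) < pi / 4 - arctan t\<close> \<open>pi / 4 - arctan t < pi / 2\<close> cos_gt_zero_pi by force
    ultimately show "tan (pi / 4 - arctan t) = (1 - t) / (1 + t)"
      by (subst tan_diff) (auto simp: cos_45 tan_45 tan_arctan)
  qed
  have "pi / 4 < arctan s + arctan t \<longleftrightarrow> arctan ((1 - t) / (1 + t)) < arctan s" using * by linarith
  also have "\<dots> \<longleftrightarrow> 1 < s + t + s * t" using assms by (simp add: arctan_less_iff field_simps)
  finally show "pi / 4 < arctan s + arctan t \<longleftrightarrow> 1 < s + t + s * t" .
  have "arctan s + arctan t = pi / 4 \<longleftrightarrow> arctan s = arctan ((1 - t) / (1 + t))" using * by linarith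
  also have "\<dots> \<longleftrightarrow> s + t + s * t = 1" using assms by (simp add: arctan_eq_iff field_simps)
  finally show "arctan s + arctan t = pi / 4 \<longleftrightarrow> s + t + s * t = 1" .
qed

text \<open>Symmetry makes the discriminant a sum of squares, so the eigenvalues \<open>s\<close>
  and \<open>t\<close> are real. Nonnegative determinant gives \<open>r \<le> T\<close>, hence both
  are nonnegative, and \<open>s + t + s * t\<close> is trace plus determinant.\<close>

lemma sum_arctan_eigenvalues_compare:
  fixes A :: "real^2^2"
  assumes sym: "A$1$2 = A$2$1" and tr: "0 \<le> A$1$1 + A$2$2" and det: "0 \<le> det A"
  shows "pi / 4 < sum_arctan_eigenvalues A \<longleftrightarrow> 1 < A$1$1 + A$2$2 + det A"
    and "sum_arctan_eigenvalues A = pi / 4 \<longleftrightarrow> A$1$1 + A$2$2 + det A = 1"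
proof -
  define T where "T = A$1$1 + A$2$2"
  define r where "r = sqrt (T\<^sup>2 - 4 * det A)"
  have "T\<^sup>2 - 4 * det A = (A$1$1 - A$2$2)\<^sup>2 + 4 * (A$1$2)\<^sup>2"
    using sym by (simp add: T_def det_2 power2_eq_square algebra_simps)
  then have r2: "r\<^sup>2 = T\<^sup>2 - 4 * det A" by (simp add: r_def)
  have r: "0 \<le> r" "r \<le> T"
    using det tr r2 by (auto simp: r_def T_def intro!: real_le_lsqrt)
  define s t where "s = (T + r) / 2" and "t = (T - r) / 2"
  have st: "A$1$1 + A$2$2 = s + t" by (simp add: s_def t_def T_def field_simps)
  have det_st: "det A = s * t"
    using r2 by (simp add: s_def t_def field_simps power2_eq_square)
  have "0 \<le> s" "0 \<le> t" using r by (auto simp: s_def t_def)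
  then show "pi / 4 < sum_arctan_eigenvalues A \<longleftrightarrow> 1 < A$1$1 + A$2$2 + det A"
    "sum_arctan_eigenvalues A = pi / 4 \<longleftrightarrow> A$1$1 + A$2$2 + det A = 1"
    unfolding sum_arctan_eigenvalues2[OF st det_st] st det_st
    by (rule arctan_add_nonneg_compare)+
qed

text \<open>Trace plus determinant of the curvature matrix of a function with gradient \<open>p\<close> and symmetric
  Hessian \<open>H\<close>. When these are nonnegative, the sum of the arctangents is compared with \<open>\<pi>/4\<close>
  by comparing this with 1.\<close>

definition curvature_functional :: "real^2 \<Rightarrow> real^2^2 \<Rightarrow> real" where
  "curvature_functional p H = (let W = sqrt (1 + (norm p)\<^sup>2) in
     ((1 + (p$2)\<^sup>2) * H$1$1 - 2 * p$1 * p$2 * H$1$2 + (1 + (p$1)\<^sup>2) * H$2$2) / W ^ 3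
     + (H$1$1 * H$2$2 - (H$1$2)\<^sup>2) / W ^ 4)"

text \<open>By cyclicity the trace of \<open>B ** H ** B\<close> is that of
  \<open>B ** B ** H\<close>, where \<open>B ** B\<close> is the inverse of
  \<open>mat 1 + tensor p p\<close> for the gradient \<open>p\<close>. The determinant follows from
  \<open>det B = 1 / W\<close>. Semidefiniteness of the Hessian makes both trace and determinant
  nonnegative.\<close>

lemma curvature_matrix_compare:
  fixes S :: "(real^2) set"
  assumes psd: "pos_semidef (hessian S u x)"
  shows "pi / 4 < sum_arctan_eigenvalues (curvature_matrix S u x) \<longleftrightarrow>
      1 < curvature_functional (gradient S u x) (hessian S u x)"
    and "sum_arctan_eigenvalues (curvature_matrix S u x) = pi / 4 \<longleftrightarrow>
      curvature_functional (gradient S u x) (hessian S u x) = 1"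
proof -
  define p q H where "p = gradient S u x $ 1" "q = gradient S u x $ 2" "H = hessian S u x"
  note defs = this
  define W where "W = sqrt (1 + (norm (gradient S u x))\<^sup>2)"
  define k where "k = 1 / (W * (1 + W))"
  define A where "A = curvature_matrix S u x"
  define B where "B = mat 1 - k *\<^sub>R tensor (gradient S u x) (gradient S u x)"
  have W2: "W\<^sup>2 = 1 + p\<^sup>2 + q\<^sup>2" and W: "W > 0"
    unfolding W_def power2_norm_eq_inner inner_vec_def sum_2 defs
    by (auto simp: power2_eq_square add_nonneg_eq_0_iff add_pos_nonneg add_nonneg_pos)
  have A: "A = (1 / W) *\<^sub>R (B ** H ** B)"
    unfolding A_def curvature_matrix_def Let_def matrix_inv_mat_sqrt_tensor B_def k_def W_def defs ..
  have B: "B$1$1 = 1 - k * p\<^sup>2" "B$1$2 = - k * p * q" "B$2$1 = - k * p * q" "B$2$2 = 1 - k * q\<^sup>2"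
    by (simp_all add: B_def mat_def tensor_def defs power2_eq_square)
  obtain a b c where H: "H$1$1 = a" "H$1$2 = b" "H$2$1 = b" "H$2$2 = c" and abc: "0 \<le> a" "0 \<le> c" "b\<^sup>2 \<le> a * c"
    using psd by (auto simp: pos_semidef2_iff defs)
  have k: "k * (W * (1 + W)) = 1" using W by (simp add: k_def)
  \<comment> \<open>The eigenvalue of \<open>B\<close> along the gradient; the other one is 1, so
    this is also \<open>det B\<close>.\<close>
  have kW: "1 - k * (p\<^sup>2 + q\<^sup>2) = 1 / W"
  proof -
    have pq: "p\<^sup>2 + q\<^sup>2 = (W - 1) * (1 + W)" using W2 by (simp add: algebra_simps power2_eq_square)
    have "W * (1 - k * (p\<^sup>2 + q\<^sup>2)) = W - (W - 1) * (k * (W * (1 + W)))"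
      unfolding pq by (simp add: algebra_simps)
    also have "\<dots> = 1" unfolding k by simp
    finally show ?thesis using W by (simp add: eq_divide_eq mult.commute)
  qed
  have detB: "det B = 1 / W" using kW by (simp add: det_2 B algebra_simps power2_eq_square)
  \<comment> \<open>The coefficient of the subtracted tensor in \<open>B ** B\<close>.\<close>
  have sq: "2 * k - k\<^sup>2 * (p\<^sup>2 + q\<^sup>2) = 1 / W\<^sup>2"
  proof -
    have "k * (1 + (1 - k * (p\<^sup>2 + q\<^sup>2))) = k * (1 + 1 / W)" unfolding kW ..
    also have "1 + 1 / W = (1 + W) / W" using W by (simp add: field_simps)
    also have "k * \<dots> = 1 / W\<^sup>2" using W by (simp add: k_def power2_eq_square)
    finally show ?thesis by (simp add: algebra_simps power2_eq_square)
  qed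
  have sq': "z - (2 * k - k\<^sup>2 * (p\<^sup>2 + q\<^sup>2)) * y = (z * W\<^sup>2 - y) / W\<^sup>2" for y z
    unfolding sq using W by (simp add: field_simps)
  have B2: "(B$1$1)\<^sup>2 + (B$1$2)\<^sup>2 = (1 + q\<^sup>2) / W\<^sup>2" "B$1$2 * (B$1$1 + B$2$2) = - p * q / W\<^sup>2"
    "(B$1$2)\<^sup>2 + (B$2$2)\<^sup>2 = (1 + p\<^sup>2) / W\<^sup>2"
    using sq'[of 1 "p\<^sup>2"] sq'[of 0 "p * q"] sq'[of 1 "q\<^sup>2"] unfolding B
    by (simp_all add: W2, simp_all add: algebra_simps power2_eq_square)
  have sym: "A$1$2 = A$2$1" by (simp add: A matrix2_mult_nth H B algebra_simps)
  have "A$1$1 + A$2$2 = (((B$1$1)\<^sup>2 + (B$1$2)\<^sup>2) * a + 2 * (B$1$2 * (B$1$1 + B$2$2)) * b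
      + ((B$1$2)\<^sup>2 + (B$2$2)\<^sup>2) * c) / W"
    by (simp add: A matrix2_mult_nth H add_divide_distrib[symmetric])
      (simp add: B(2,3) algebra_simps power2_eq_square)
  also have "\<dots> = ((1 + q\<^sup>2) * a - 2 * p * q * b + (1 + p\<^sup>2) * c) / W ^ 3"
    unfolding B2 using W by (simp add: field_simps power2_eq_square power3_eq_cube)
  finally have tr: "A$1$1 + A$2$2 = ((1 + q\<^sup>2) * a - 2 * p * q * b + (1 + p\<^sup>2) * c) / W ^ 3" .
  have "det A = det (B ** H ** B) / W\<^sup>2"
    by (simp add: A det_2[of "_ *\<^sub>R _"] det_2[of "B ** H ** B"] diff_divide_distrib power2_eq_square)
  moreover have "det H = a * c - b\<^sup>2" by (simp add: det_2 H power2_eq_square)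
  ultimately have "det A = (det B)\<^sup>2 * (a * c - b\<^sup>2) / W\<^sup>2"
    by (simp add: det_mul power2_eq_square)
  then have det: "det A = (a * c - b\<^sup>2) / W ^ 4"
    using W by (simp add: detB field_simps eval_nat_numeral)
  \<comment> \<open>The numerator of the trace is \<open>a + c\<close> plus the form of
    \<open>H\<close> at \<open>(q, -p)\<close>.\<close>
  have "0 \<le> a + c + (a * q\<^sup>2 + 2 * b * q * (- p) + c * (- p)\<^sup>2)"
    using binary_form_nonneg_iff[THEN iffD2, of a c b, rule_format, of q "- p"] abc by simp
  then have "0 \<le> A$1$1 + A$2$2" unfolding tr using W by (simp add: algebra_simps)
  moreover have "0 \<le> det A" unfolding det using abc W by simp
  moreover have "curvature_functional (gradient S u x) (hessian S u x) = A$1$1 + A$2$2 + det A"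
    unfolding tr det curvature_functional_def Let_def W_def[symmetric]
    by (simp add: H[unfolded defs] defs)
  ultimately show "pi / 4 < sum_arctan_eigenvalues (curvature_matrix S u x) \<longleftrightarrow>
      1 < curvature_functional (gradient S u x) (hessian S u x)"
    "sum_arctan_eigenvalues (curvature_matrix S u x) = pi / 4 \<longleftrightarrow>
      curvature_functional (gradient S u x) (hessian S u x) = 1"
    using sum_arctan_eigenvalues_compare[OF sym] unfolding A_def by auto
qed

text \<open>The trace term is linear in the Hessian and nonnegative on semidefinite matrices. The
  determinant of a sum is the sum of the determinants plus the mixed term
  \<open>a * f + c * d - 2 * b * e\<close>, nonnegative by the inequality of arithmetic and
  geometric means.\<close>

lemma curvature_functional_mono:
  assumes H: "pos_semidef H" and le: "pos_semidef (H' - H)"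
  shows "curvature_functional p H \<le> curvature_functional p H'"
proof -
  obtain a b c where h: "H$1$1 = a" "H$1$2 = b" "H$2$1 = b" "H$2$2 = c" and abc: "0 \<le> a" "0 \<le> c" "b\<^sup>2 \<le> a * c"
    using H by (auto simp: pos_semidef2_iff)
  define d e f where "d = H'$1$1 - a" "e = H'$1$2 - b" "f = H'$2$2 - c"
  have def: "0 \<le> d" "0 \<le> f" "e\<^sup>2 \<le> d * f"
    using le h by (auto simp: pos_semidef2_iff d_e_f_def)
  have h': "H'$1$1 = a + d" "H'$1$2 = b + e" "H'$2$2 = c + f" by (simp_all add: d_e_f_def)
  define W where "W = sqrt (1 + (norm p)\<^sup>2)"
  have W: "W > 0" by (simp add: W_def add_pos_nonneg)
  have "0 \<le> d + f + (d * (p$2)\<^sup>2 + 2 * e * p$2 * (- p$1) + f * (- p$1)\<^sup>2)"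
    using binary_form_nonneg_iff[THEN iffD2, of d f e, rule_format, of "p$2" "- p$1"] def by simp
  then have 1: "(1 + (p$2)\<^sup>2) * a - 2 * p$1 * p$2 * b + (1 + (p$1)\<^sup>2) * c \<le>
     (1 + (p$2)\<^sup>2) * (a + d) - 2 * p$1 * p$2 * (b + e) + (1 + (p$1)\<^sup>2) * (c + f)"
    by (simp add: algebra_simps)
  have "(2 * (b * e))\<^sup>2 \<le> (a * f + c * d)\<^sup>2"
  proof -
    have "b\<^sup>2 * e\<^sup>2 \<le> (a * c) * (d * f)" using abc def by (intro mult_mono) auto
    moreover have "4 * ((a * f) * (c * d)) \<le> (a * f + c * d)\<^sup>2"
      using sum_squares_bound[of "a * f" "c * d"] by (simp add: power2_eq_square algebra_simps)
    ultimately show ?thesis by (simp add: power_mult_distrib algebra_simps)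
  qed
  then have "2 * (b * e) \<le> a * f + c * d"
    using abc def by (meson add_nonneg_nonneg mult_nonneg_nonneg power2_le_imp_le)
  then have 2: "a * c - b\<^sup>2 \<le> (a + d) * (c + f) - (b + e)\<^sup>2"
    using def by (simp add: algebra_simps power2_eq_square)
  show ?thesis
    unfolding curvature_functional_def Let_def W_def[symmetric] h h'
    using W by (intro add_mono[OF divide_right_mono[OF 1] divide_right_mono[OF 2]]) auto
qed

subsection \<open>The disc and the perturbed cylinder\<close>

text \<open>Near each boundary point the circle is the same arc \<open>g\<close> over its tangent,
  with second derivative \<open>1 / r\<close> at 0, so \<open>1 / r\<close> serves as the curvature
  bound.\<close>

lemma smooth_uniformly_convex_domain_ball:
  assumes r: "r > 0"
  shows "smooth_uniformly_convex_domain (ball (0::real^2) r)"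
proof -
  have "\<exists>r' e n g. boundary_graph_at (ball 0 r) p r' e n g \<and> 1 / r \<le> deriv (deriv g) 0"
    if "p \<in> frontier (ball 0 r)" for p :: "real^2"
  proof -
    have "(norm p)\<^sup>2 = r\<^sup>2" using r that by (simp add: frontier_ball)
    then have p: "p$1 * p$1 + p$2 * p$2 = r * r"
      unfolding power2_norm_eq_inner by (simp add: inner_vec_def sum_2 power2_eq_square)
    define \<rho> where "\<rho> = r / 2"
    \<comment> \<open>The outer normal \<open>p / r\<close> turned by a quarter, and its
      negative.\<close>
    define e n :: "real^2" where "e = vector [- p$2 / r, p$1 / r]" and "n = vector [- p$1 / r, - p$2 / r]"
    define g where "g t = r - sqrt (r\<^sup>2 - t\<^sup>2)" for t
    define g' where "g' t = t * inverse (sqrt (r\<^sup>2 - t\<^sup>2))" for t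
    have \<rho>: "0 < \<rho>" "\<rho> < r" using r by (auto simp: \<rho>_def)
    have less: "t\<^sup>2 < r\<^sup>2" if "t \<in> {-\<rho><..<\<rho>}" for t
      using that \<rho> power_strict_mono[of "\<bar>t\<bar>" r 2] by auto
    have g: "(g has_real_derivative g' t) (at t)" if "t \<in> {-\<rho><..<\<rho>}" for t
      using less[OF that] unfolding g_def g'_def
      by (auto intro!: derivative_eq_intros simp: field_simps)
    have "(g' has_real_derivative 1 / r) (at 0)"
      unfolding g'_def using r by (auto intro!: derivative_eq_intros simp: field_simps)
    \<comment> \<open>Differentiating \<open>deriv g\<close> at 0 requires its closed form on a
      whole neighbourhood.\<close>
    moreover have "\<forall>\<^sub>F t in nhds 0. deriv g t = g' t"
      by (rule eventually_mono[OF eventually_nhds_in_open[of "{-\<rho><..<\<rho>}"] DERIV_imp_deriv[OF g]])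
        (use \<rho> in auto)
    ultimately have g2: "deriv (deriv g) 0 = 1 / r"
      using deriv_cong_ev[of "deriv g" g' 0 0] DERIV_imp_deriv by metis
    have "boundary_graph_at (ball 0 r) p \<rho> e n g"
      unfolding boundary_graph_at_def
    proof (intro conjI)
      have "(norm e)\<^sup>2 = 1" "(norm n)\<^sup>2 = 1"
        unfolding power2_norm_eq_inner using p r
        by (simp_all add: inner_vec_def sum_2 e_def n_def add_divide_distrib[symmetric] add.commute)
      then show "norm e = 1" "norm n = 1" by (simp_all add: power2_eq_1_iff) (smt (verit) norm_ge_zero)+
      show "e \<bullet> n = 0" by (simp add: inner_vec_def sum_2 e_def n_def)
      show "smooth_on {-\<rho><..<\<rho>} g"
        unfolding smooth_on_def g_def using less \<rho>
        by (auto intro!: Ck_on_diff Ck_on_const Ck_on_sqrt_diff_squares[where l = "\<lambda>t. t"] bounded_linear_ident)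
      show "g 0 = 0" using r by (simp add: g_def)
      show "deriv g 0 = 0" using DERIV_imp_deriv[OF g[of 0]] \<rho> by (simp add: g'_def)
      have "x \<in> ball 0 r \<longleftrightarrow> g ((x - p) \<bullet> e) < (x - p) \<bullet> n" if x: "x \<in> ball p \<rho>" for x
      proof -
        define a b where "a = (x - p) \<bullet> e" and "b = (x - p) \<bullet> n"
        have a: "r * a = x$2 * p$1 - x$1 * p$2"
          using r by (simp add: a_def inner_vec_def sum_2 e_def field_simps)
        have b: "r * b = r * r - (x$1 * p$1 + x$2 * p$2)"
          unfolding p[symmetric] using r by (simp add: b_def inner_vec_def sum_2 n_def field_simps)
        have "norm (x - p) < \<rho>" using x by (simp add: dist_norm norm_minus_commute)
        \<comment> \<open>The bound on \<open>b\<close> makes \<open>r - b\<close> positive, so only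
          the arc nearest \<open>p\<close> matters and square roots may be taken below.\<close>
        then have ab: "\<bar>a\<bar> < r" "\<bar>b\<bar> < r"
          using Cauchy_Schwarz_ineq2[of "x - p" e] Cauchy_Schwarz_ineq2[of "x - p" n] \<open>norm e = 1\<close> \<open>norm n = 1\<close> \<rho>
          by (auto simp: a_def b_def)
        have "(r * r) * (a\<^sup>2 + (r - b)\<^sup>2) = (r * a)\<^sup>2 + (r * r - r * b)\<^sup>2"
          by (simp add: power2_eq_square algebra_simps)
        also have "\<dots> = (p$1 * p$1 + p$2 * p$2) * ((x$1)\<^sup>2 + (x$2)\<^sup>2)"
          unfolding a b by (simp add: power2_eq_square algebra_simps)
        also have "\<dots> = (r * r) * (norm x)\<^sup>2"
          unfolding p power2_norm_eq_inner by (simp add: inner_vec_def sum_2 power2_eq_square)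
        finally have nx: "(norm x)\<^sup>2 = a\<^sup>2 + (r - b)\<^sup>2" using r by simp
        have "x \<in> ball 0 r \<longleftrightarrow> (norm x)\<^sup>2 < r\<^sup>2"
          using r power2_less_imp_less[of "norm x" r] power_strict_mono[of "norm x" r 2]
          by auto
        also have "\<dots> \<longleftrightarrow> (r - b)\<^sup>2 < r\<^sup>2 - a\<^sup>2" unfolding nx by linarith
        also have "\<dots> \<longleftrightarrow> sqrt ((r - b)\<^sup>2) < sqrt (r\<^sup>2 - a\<^sup>2)"
          by (simp only: real_sqrt_less_iff)
        also have "\<dots> \<longleftrightarrow> g a < b" using ab by (auto simp: g_def)
        finally show ?thesis by (simp add: a_def b_def)
      qed
      then show "ball 0 r \<inter> ball p \<rho> = {x \<in> ball p \<rho>. g ((x - p) \<bullet> e) < (x - p) \<bullet> n}" by blast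
    qed (use \<rho> in simp)
    with g2 show ?thesis
      by fastforce
  qed
  then have "\<exists>\<kappa>>0. \<forall>p\<in>frontier (ball (0::real^2) r). \<exists>r' e n g.
      boundary_graph_at (ball 0 r) p r' e n g \<and> \<kappa> \<le> deriv (deriv g) 0"
    using r zero_less_divide_1_iff by blast
  then show ?thesis
    unfolding smooth_uniformly_convex_domain_def using r by simp
qed

section \<open>The perturbed cylinder\<close>

text \<open>One family holds the solution (\<open>e = 0\<close>), the lower barriers
  (\<open>e > 0\<close>) and the upper barriers (\<open>e < 0\<close>). The constant
  \<open>1 / 16\<close> is the squared radius of the disc, so all members agree on its
  boundary.\<close>

definition bent_cylinder :: "real \<Rightarrow> real^2 \<Rightarrow> real" where
  "bent_cylinder e x = e / 2 * ((x$1)\<^sup>2 + (x$2)\<^sup>2 - 1 / 16) - sqrt (1 - (x$1)\<^sup>2)"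

context
  fixes S :: "(real^2) set"
  assumes S: "convex S" "interior S \<noteq> {}" and S1: "\<forall>x\<in>S. (x$1)\<^sup>2 < 1"
begin

lemma smooth_on_bent_cylinder: "smooth_on S (bent_cylinder e)"
proof -
  have "Ck_on k S (\<lambda>x. sqrt (1\<^sup>2 - (x$1)\<^sup>2))" for k
    by (rule Ck_on_sqrt_diff_squares[OF S bounded_linear_vec_nth]) (simp add: S1)
  then show ?thesis
    unfolding smooth_on_def bent_cylinder_def[abs_def]
    by (intro allI Ck_on_diff Ck_on_mult Ck_on_add Ck_on_power Ck_on_const S
        Ck_on_bounded_linear[OF S bounded_linear_vec_nth]) simp
qed

lemma gradient_bent_cylinder:
  assumes x: "x \<in> S"
  shows "deriv_within S (axis 1 1) (bent_cylinder e) x = e * x$1 + x$1 * inverse (sqrt (1 - (x$1)\<^sup>2))"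
    and "deriv_within S (axis 2 1) (bent_cylinder e) x = e * x$2"
proof -
  have "(bent_cylinder e has_derivative (\<lambda>v. e * (x$1 * v$1 + x$2 * v$2) + x$1 * v$1 * inverse (sqrt (1 - (x$1)\<^sup>2))))
      (at x within S)"
    unfolding bent_cylinder_def[abs_def] using S1[rule_format, OF x]
    by (auto intro!: derivative_eq_intros bounded_linear_imp_has_derivative[OF bounded_linear_vec_nth]
        simp: fun_eq_iff field_simps)
  from deriv_within_eqI[OF S x this]
  show "deriv_within S (axis 1 1) (bent_cylinder e) x = e * x$1 + x$1 * inverse (sqrt (1 - (x$1)\<^sup>2))"
    "deriv_within S (axis 2 1) (bent_cylinder e) x = e * x$2"
    by (simp_all add: axis_def)
qed

lemma hessian_bent_cylinder:
  assumes x: "x \<in> S"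
  shows "hessian S (bent_cylinder e) x $ 1 $ 1 = e + inverse (sqrt (1 - (x$1)\<^sup>2)) ^ 3"
    and "hessian S (bent_cylinder e) x $ 1 $ 2 = 0"
    and "hessian S (bent_cylinder e) x $ 2 $ 1 = 0"
    and "hessian S (bent_cylinder e) x $ 2 $ 2 = e"
proof -
  define h where "h = inverse (sqrt (1 - (x$1)\<^sup>2))"
  have "((\<lambda>x. e * x$1 + x$1 * inverse (sqrt (1\<^sup>2 - (x$1)\<^sup>2))) has_derivative
      (\<lambda>v. e * v$1 + (x$1 * (x$1 * v$1 * inverse (sqrt (1\<^sup>2 - (x$1)\<^sup>2)) ^ 3)
         + v$1 * inverse (sqrt (1\<^sup>2 - (x$1)\<^sup>2))))) (at x within S)"
    using S1[rule_format, OF x]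
    by (intro has_derivative_add has_derivative_mult has_derivative_mult_right
        bounded_linear_imp_has_derivative[OF bounded_linear_vec_nth]
        has_derivative_inverse_sqrt_diff_squares[OF S bounded_linear_vec_nth]) simp
  from deriv_within_eqI[OF S x this]
  have D1: "deriv_within S b (deriv_within S (axis 1 1) (bent_cylinder e)) x = e * b$1 + (x$1 * (x$1 * b$1 * h ^ 3) + b$1 * h)"
    for b
    using deriv_within_cong[OF gradient_bent_cylinder(1) x] by (simp add: h_def)
  have "((\<lambda>x. e * x$2) has_derivative (\<lambda>v. e * v$2)) (at x within S)"
    by (intro has_derivative_mult_right bounded_linear_imp_has_derivative[OF bounded_linear_vec_nth])
  from deriv_within_eqI[OF S x this]
  have D2: "deriv_within S b (deriv_within S (axis 2 1) (bent_cylinder e)) x = e * b$2" for b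
    using deriv_within_cong[OF gradient_bent_cylinder(2) x] by simp
  \<comment> \<open>This relation collapses the two terms of the second derivative of the root into
    the single power \<open>h ^ 3\<close>.\<close>
  have "h * h * (1 - (x$1)\<^sup>2) = 1"
    using S1[rule_format, OF x] by (simp add: h_def field_simps)
  moreover have "(x$1)\<^sup>2 * h ^ 3 + h * (h * h * (1 - (x$1)\<^sup>2)) = h ^ 3"
    by (simp add: algebra_simps power3_eq_cube)
  ultimately have "x$1 * (x$1 * h ^ 3) + h = h ^ 3" by (simp add: power2_eq_square mult.assoc)
  moreover have axis: "axis 1 1 $ 1 = (1::real)" "axis 2 1 $ (1::2) = (0::real)"
    "axis 1 1 $ (2::2) = (0::real)" "axis 2 1 $ 2 = (1::real)"
    by (simp_all add: axis_def)
  ultimately show "hessian S (bent_cylinder e) x $ 1 $ 1 = e + inverse (sqrt (1 - (x$1)\<^sup>2)) ^ 3"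
    unfolding h_def[symmetric] by (simp add: hessian_def D1)
  show "hessian S (bent_cylinder e) x $ 1 $ 2 = 0" "hessian S (bent_cylinder e) x $ 2 $ 1 = 0"
    "hessian S (bent_cylinder e) x $ 2 $ 2 = e"
    by (simp_all add: hessian_def D1 D2 axis)
qed

lemma pos_semidef_hessian_bent_cylinder: "x \<in> S \<Longrightarrow> 0 \<le> e \<Longrightarrow> pos_semidef (hessian S (bent_cylinder e) x)"
  using S1[rule_format, of x] by (simp add: pos_semidef2_iff hessian_bent_cylinder)

text \<open>Here \<open>W = h\<close> and the Hessian is diagonal with entries \<open>h ^ 3\<close>
  and 0, so the trace term is 1 and the determinant term 0.\<close>

lemma curvature_functional_cylinder:
  assumes x: "x \<in> S"
  shows "curvature_functional (gradient S (bent_cylinder 0) x) (hessian S (bent_cylinder 0) x) = 1"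
proof -
  define h where "h = inverse (sqrt (1 - (x$1)\<^sup>2))"
  have h: "h > 0" "h\<^sup>2 * (1 - (x$1)\<^sup>2) = 1"
    using S1[rule_format, OF x] by (simp_all add: h_def field_simps)
  have p: "gradient S (bent_cylinder 0) x $ 1 = x$1 * h" "gradient S (bent_cylinder 0) x $ 2 = 0"
    by (simp_all add: gradient_def gradient_bent_cylinder x h_def)
  have "1 + (norm (gradient S (bent_cylinder 0) x))\<^sup>2 = h\<^sup>2"
    unfolding power2_norm_eq_inner using h
    by (simp add: inner_vec_def sum_2 p) (simp add: algebra_simps power2_eq_square)
  then have "sqrt (1 + (norm (gradient S (bent_cylinder 0) x))\<^sup>2) = h" using h by simp
  then show ?thesis
    using h by (simp add: curvature_functional_def Let_def hessian_bent_cylinder x h_def[symmetric] p)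
qed

text \<open>The numerator of the trace term is at least \<open>h ^ 3 + 2 * e\<close>, so it suffices
  that \<open>W ^ 3\<close> is smaller. On the small disc \<open>W - h \<le> e / 10\<close> with
  \<open>W\<close> and \<open>h\<close> at most \<open>6 / 5\<close>, so the cubes differ by less
  than \<open>e / 2\<close>.\<close>

lemma curvature_functional_bent_cylinder:
  assumes x: "x \<in> S" and small: "(x$1)\<^sup>2 + (x$2)\<^sup>2 \<le> 1 / 16" and e: "0 < e" "e \<le> 1"
  shows "1 < curvature_functional (gradient S (bent_cylinder e) x) (hessian S (bent_cylinder e) x)"
proof -
  define h where "h = inverse (sqrt (1 - (x$1)\<^sup>2))"
  define p where "p = gradient S (bent_cylinder e) x"
  have p: "p$1 = e * x$1 + x$1 * h" "p$2 = e * x$2"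
    by (simp_all add: p_def gradient_def gradient_bent_cylinder x h_def)
  have x1: "(x$1)\<^sup>2 \<le> 1 / 16" using small by (smt (verit) zero_le_power2)
  have h: "h > 0" "h\<^sup>2 * (1 - (x$1)\<^sup>2) = 1"
    using S1[rule_format, OF x] by (simp_all add: h_def field_simps)
  have "h\<^sup>2 * (15 / 16) \<le> h\<^sup>2 * (1 - (x$1)\<^sup>2)" using x1 by (intro mult_left_mono) auto
  then have h2: "h\<^sup>2 \<le> 16 / 15" using h by simp
  have "1 \<le> h\<^sup>2" using h x1 by (smt (verit) mult_left_le zero_le_power2)
  then have h1: "1 \<le> h" using h by (intro power2_le_imp_le[of 1 h]) auto
  have "h * 1 \<le> h * h" using h1 by (intro mult_left_mono) auto
  then have hle: "h \<le> 16 / 15" using h2 by (simp add: power2_eq_square)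
  define W where "W = sqrt (1 + (norm p)\<^sup>2)"
  have W2: "W\<^sup>2 = 1 + (p$1)\<^sup>2 + (p$2)\<^sup>2" and W: "W > 0"
    unfolding W_def power2_norm_eq_inner inner_vec_def sum_2
    by (auto simp: power2_eq_square add_nonneg_eq_0_iff add_pos_nonneg add_nonneg_pos)
  \<comment> \<open>\<open>e * d\<close> is the excess of the square of \<open>W\<close> over that
    of \<open>h\<close>; the bounds \<open>2 / 15\<close> and \<open>1 / 16\<close> on its two
    summands give \<open>d \<le> 1 / 5\<close>.\<close>
  define d where "d = 2 * h * (x$1)\<^sup>2 + e * ((x$1)\<^sup>2 + (x$2)\<^sup>2)"
  have Wd: "W\<^sup>2 = h\<^sup>2 + e * d"
    using h(2) unfolding W2 p d_def by (simp add: algebra_simps power2_eq_square)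
  have d0: "0 \<le> d" using h e by (simp add: d_def)
  have "h * (x$1)\<^sup>2 \<le> 16 / 15 * (1 / 16)" using hle x1 h by (intro mult_mono) auto
  moreover have "e * ((x$1)\<^sup>2 + (x$2)\<^sup>2) \<le> 1 * (1 / 16)" using e small by (intro mult_mono) auto
  ultimately have d1: "d \<le> 1 / 5" unfolding d_def by linarith
  have ed: "e * d \<le> e * (1 / 5)" "0 \<le> e * d" using e d0 d1 by (auto intro: mult_left_mono)
  have "W\<^sup>2 \<le> 36 / 25" using Wd ed h2 e by linarith
  then have "W\<^sup>2 \<le> (6 / 5)\<^sup>2" by (simp add: power2_eq_square)
  then have W65: "W \<le> 6 / 5" by (rule power2_le_imp_le) simp
  have hW: "h \<le> W" using Wd ed W by (intro power2_le_imp_le[of h W]) auto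
  \<comment> \<open>Since \<open>W + h\<close> is at least 2, the bound on the difference of squares
    passes to \<open>W - h\<close>.\<close>
  have "(W - h) * 2 \<le> (W - h) * (W + h)" using h1 hW by (intro mult_left_mono) auto
  also have "\<dots> = e * d" using Wd by (simp add: power2_eq_square algebra_simps)
  finally have Wh: "W - h \<le> e / 10" using ed by simp
  have "W * W \<le> 6 / 5 * (6 / 5)" "W * h \<le> 6 / 5 * (6 / 5)" "h * h \<le> 6 / 5 * (6 / 5)"
    using W65 hW h W by (intro mult_mono; simp)+
  then have "(W - h) * (W * W + W * h + h * h) \<le> e / 10 * (3 * (6 / 5 * (6 / 5)))"
    using Wh hW e h W by (intro mult_mono) auto
  moreover have "W ^ 3 - h ^ 3 = (W - h) * (W * W + W * h + h * h)"
    by (simp add: algebra_simps power3_eq_cube)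
  ultimately have W3: "W ^ 3 < h ^ 3 + 2 * e" using e by simp
  have "0 < e + h ^ 3" using e h by (simp add: add_pos_pos)
  then have "e + h ^ 3 \<le> (1 + (p$2)\<^sup>2) * (e + h ^ 3)" "e \<le> (1 + (p$1)\<^sup>2) * e"
    using e h by (auto simp: mult_le_cancel_right1)
  then have "W ^ 3 < (1 + (p$2)\<^sup>2) * (e + h ^ 3) + (1 + (p$1)\<^sup>2) * e" using W3 by linarith
  then have "1 < ((1 + (p$2)\<^sup>2) * (e + h ^ 3) + (1 + (p$1)\<^sup>2) * e) / W ^ 3" using W by simp
  moreover have "0 \<le> (e + h ^ 3) * e / W ^ 4" using W e h by simp
  ultimately show ?thesis
    unfolding p_def[symmetric] curvature_functional_def Let_def W_def[symmetric]
    by (simp add: hessian_bent_cylinder x h_def[symmetric])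
qed

end

lemma bent_cylinder_eq: "bent_cylinder e x = bent_cylinder 0 x + e / 2 * ((norm x)\<^sup>2 - 1 / 16)"
  unfolding bent_cylinder_def power2_norm_eq_inner by (simp add: inner_vec_def sum_2 power2_eq_square)

section \<open>The example and uniqueness by comparison\<close>

theorem proposition6p4:
  shows "\<exists>(\<Omega> :: (real^2) set) (\<phi> :: real^2 \<Rightarrow> real) (\<theta> :: real).
    smooth_uniformly_convex_domain \<Omega> \<and> smooth_on (closure \<Omega>) \<phi> \<and> 0 < \<theta> \<and> \<theta> < pi / 2 \<and>
    (\<exists>v. strict_lower_subsolution \<Omega> \<phi> \<theta> v) \<and>
    (\<exists>u. smooth_convex_solution \<Omega> \<phi> \<theta> u \<and>
         (\<forall>w. smooth_convex_solution \<Omega> \<phi> \<theta> w \<longrightarrow> (\<forall>x\<in>closure \<Omega>. w x = u x)) \<and>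
         \<not> strictly_convex \<Omega> u)"
proof -
  define \<Omega> :: "(real^2) set" where "\<Omega> = ball 0 (1 / 4)"
  define S where "S = closure \<Omega>"
  have S_eq: "S = cball 0 (1 / 4)" and int: "interior S = \<Omega>" and fr: "frontier \<Omega> = S - \<Omega>"
    by (auto simp: S_def \<Omega>_def frontier_def)
  have \<Omega>S: "x \<in> S" if "x \<in> \<Omega>" for x
    using closure_subset that by (auto simp: S_def)
  have S: "convex S" "interior S \<noteq> {}" by (simp_all add: S_eq)
  have n2: "(norm x)\<^sup>2 = (x$1)\<^sup>2 + (x$2)\<^sup>2" for x :: "real^2"
    unfolding power2_norm_eq_inner by (simp add: inner_vec_def sum_2 power2_eq_square)
  have nS: "(norm x)\<^sup>2 \<le> 1 / 16" if "x \<in> S" for x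
    using that power_mono[of "norm x" "1 / 4" 2] by (simp add: S_eq power2_eq_square)
  have S1: "\<forall>x\<in>S. (x$1)\<^sup>2 < 1"
  proof
    show "(x$1)\<^sup>2 < 1" if "x \<in> S" for x
      using nS[OF that] n2[of x] zero_le_power2[of "x$2"] by linarith
  qed
  note smooth = smooth_on_bent_cylinder[OF S S1] and hess = hessian_bent_cylinder[OF S S1]
    and psd = pos_semidef_hessian_bent_cylinder[OF S S1]
    and cylinder = curvature_functional_cylinder[OF S S1]
    and bent = curvature_functional_bent_cylinder[OF S S1]
  have bdry: "bent_cylinder e x = bent_cylinder 0 x" if "x \<in> frontier \<Omega>" for e x
  proof -
    have "norm x = 1 / 4" using that by (simp add: \<Omega>_def)
    then have "(norm x)\<^sup>2 = 1 / 16" by (simp only:) (simp add: power2_eq_square)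
    then show ?thesis by (simp add: bent_cylinder_eq[of e])
  qed
  have gt: "1 < curvature_functional (gradient S (bent_cylinder e) x) (hessian S (bent_cylinder e) x)"
    if "x \<in> S" "0 < e" "e \<le> 1" for x e
    using bent[OF that(1) _ that(2,3)] nS[OF that(1)] n2 by simp
  \<comment> \<open>Any parameter in \<open>(0, 1]\<close> would serve; with 1 the Hessian is
    diagonal with entries \<open>1 + h ^ 3\<close> and 1.\<close>
  have sub: "strict_lower_subsolution \<Omega> (bent_cylinder 0) (pi / 4) (bent_cylinder 1)"
    unfolding strict_lower_subsolution_def strictly_convex_def S_def[symmetric]
  proof (intro conjI ballI)
    fix x assume x: "x \<in> S"
    define h where "h = inverse (sqrt (1 - (x$1)\<^sup>2))"
    have h: "h > 0" using S1 x by (simp add: h_def)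
    have "0 < v \<bullet> (hessian S (bent_cylinder 1) x *v v)" if "v \<noteq> 0" for v
    proof -
      have "0 < (v$1)\<^sup>2 + (v$2)\<^sup>2" using that by (simp add: sum_power2_gt_zero_iff vec_eq_iff forall_2)
      also have "\<dots> \<le> (1 + h ^ 3) * (v$1)\<^sup>2 + (v$2)\<^sup>2" using h by (simp add: mult_le_cancel_right1)
      finally show ?thesis using x by (simp add: inner_matrix2_vector hess h_def)
    qed
    then show "pos_def (hessian S (bent_cylinder 1) x)"
      using x by (simp add: pos_def_def symmetric2_iff hess)
    show "pi / 4 < sum_arctan_eigenvalues (curvature_matrix S (bent_cylinder 1) x)"
      unfolding curvature_matrix_compare(1)[OF psd[OF x zero_le_one]] by (rule gt[OF x]) simp_all
  next
    show "bent_cylinder 1 x = bent_cylinder 0 x" if "x \<in> frontier \<Omega>" for x using that by (rule bdry)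
  qed (rule smooth)
  have sol: "smooth_convex_solution \<Omega> (bent_cylinder 0) (pi / 4) (bent_cylinder 0)"
    unfolding smooth_convex_solution_def hessian_nonneg_def S_def[symmetric]
  proof (intro conjI ballI)
    fix x assume "x \<in> \<Omega>"
    then have x: "x \<in> S" by (rule \<Omega>S)
    show "sum_arctan_eigenvalues (curvature_matrix S (bent_cylinder 0) x) = pi / 4"
      unfolding curvature_matrix_compare(2)[OF psd[OF x order_refl]] by (rule cylinder[OF x])
  next
    show "pos_semidef (hessian S (bent_cylinder 0) x)" if "x \<in> S" for x
      using that by (rule psd) simp
  qed (simp_all only: smooth)
  have Ck: "Ck_on k S (bent_cylinder e)" for k e
    using smooth[unfolded smooth_on_def] by blast
  have unique: "w x = bent_cylinder 0 x"
    if w: "smooth_convex_solution \<Omega> (bent_cylinder 0) (pi / 4) w" and x: "x \<in> S" for w x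
  proof -
    have wCk: "Ck_on k S w" for k
      using w by (simp add: smooth_convex_solution_def smooth_on_def S_def)
    have wb: "w y = bent_cylinder e y" if "y \<in> frontier \<Omega>" for y e
      using w that bdry[OF that, of e] by (simp add: smooth_convex_solution_def)
    have wH: "pos_semidef (hessian S w y)" if "y \<in> S" for y
      using w that by (simp add: smooth_convex_solution_def hessian_nonneg_def S_def)
    have w1: "curvature_functional (gradient S w y) (hessian S w y) = 1" if "y \<in> \<Omega>" for y
    proof -
      have "y \<in> S" using that by (rule \<Omega>S)
      then show ?thesis
        using w that curvature_matrix_compare(2)[OF wH]
        unfolding smooth_convex_solution_def S_def[symmetric] by blast
    qed
    \<comment> \<open>A minimum of \<open>f - g\<close> over the compact disc is negative, whereas
      \<open>f - g\<close> vanishes on the boundary.\<close>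
    have interior_min: "\<exists>z\<in>\<Omega>. \<forall>y\<in>S. f z - g z \<le> f y - g y"
      if "Ck_on 0 S f" "Ck_on 0 S g" "f x < g x" and b: "\<And>y. y \<in> frontier \<Omega> \<Longrightarrow> f y = g y" for f g
    proof -
      have "\<exists>z\<in>S. \<forall>y\<in>S. f z - g z \<le> f y - g y"
        using that x by (intro continuous_attains_inf) (auto simp: S_eq intro!: continuous_intros)
      then obtain z where z: "z \<in> S" "\<And>y. y \<in> S \<Longrightarrow> f z - g z \<le> f y - g y" by blast
      have "f z < g z" using z(2)[OF x] that(3) by linarith
      then have "z \<notin> frontier \<Omega>" using b by force
      then show ?thesis using z fr by blast
    qed
    \<comment> \<open>At the minimum the gradients agree and the Hessian of \<open>w\<close>
      dominates, so monotonicity bounds the functional of the barrier by 1, against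
      \<open>gt\<close>.\<close>
    have lower: "bent_cylinder e x \<le> w x" if e: "0 < e" "e \<le> 1" for e
    proof (rule ccontr)
      assume "\<not> bent_cylinder e x \<le> w x"
      then obtain z where z: "z \<in> \<Omega>" "\<And>y. y \<in> S \<Longrightarrow> w z - bent_cylinder e z \<le> w y - bent_cylinder e y"
        using interior_min[OF wCk Ck _ wb, of e] by auto
      have zS: "z \<in> S" using z(1) by (rule \<Omega>S)
      note min = local_min_gradient_hessian[OF wCk Ck z(1)[folded int] z(2)]
      have "transpose (hessian S w z - hessian S (bent_cylinder e) z) = hessian S w z - hessian S (bent_cylinder e) z"
        using wH[OF zS] zS by (simp add: symmetric2_iff pos_semidef2_iff hess)
      then have "pos_semidef (hessian S w z - hessian S (bent_cylinder e) z)"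
        using min(2) by (simp add: pos_semidef_def)
      then have "curvature_functional (gradient S w z) (hessian S (bent_cylinder e) z) \<le> 1"
        using curvature_functional_mono[OF psd[OF zS]] e w1[OF z(1)] by (metis less_imp_le)
      then show False using gt[OF zS e] min(1) by simp
    qed
    \<comment> \<open>This barrier is not convex, so the monotonicity argument is replaced by
      testing the Hessians along the second axis, where the barrier has second derivative
      \<open>- e\<close>.\<close>
    have upper: "w x \<le> bent_cylinder (- e) x" if e: "0 < e" for e
    proof (rule ccontr)
      assume "\<not> w x \<le> bent_cylinder (- e) x"
      then obtain z where z: "z \<in> \<Omega>" "\<And>y. y \<in> S \<Longrightarrow> bent_cylinder (- e) z - w z \<le> bent_cylinder (- e) y - w y"
        using interior_min[OF Ck wCk _ wb[symmetric], of "- e"] by auto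
      have zS: "z \<in> S" using z(1) by (rule \<Omega>S)
      have "0 \<le> axis 2 1 \<bullet> ((hessian S (bent_cylinder (- e)) z - hessian S w z) *v axis 2 1)"
        by (rule local_min_gradient_hessian[OF Ck wCk z(1)[folded int] z(2)])
      then have "0 \<le> - e - hessian S w z $ 2 $ 2"
        using zS by (simp add: inner_matrix2_vector axis_def hess)
      then show False using wH[OF zS] e by (simp add: pos_semidef2_iff)
    qed
    show ?thesis
    proof (rule ccontr)
      assume "w x \<noteq> bent_cylinder 0 x"
      \<comment> \<open>A single parameter replaces the limit: the barriers are within
        \<open>e / 2\<close> of the cylinder at \<open>x\<close>, at most half the supposed gap. The
        cap 1 is what \<open>lower\<close> demands.\<close>
      define e where "e = min 1 \<bar>w x - bent_cylinder 0 x\<bar>"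
      have e: "0 < e" "e \<le> 1" "e \<le> \<bar>w x - bent_cylinder 0 x\<bar>"
        using \<open>w x \<noteq> bent_cylinder 0 x\<close> by (auto simp: e_def)
      have "e / 2 * (1 / 16 - (norm x)\<^sup>2) \<le> e / 2 * 1" 
        using e by (intro mult_left_mono) (auto intro: order_trans[OF diff_mono[OF _ zero_le_power2]])
      moreover have "0 \<le> e / 2 * (1 / 16 - (norm x)\<^sup>2)" using e nS[OF x] by simp
      moreover have "bent_cylinder e x = bent_cylinder 0 x - e / 2 * (1 / 16 - (norm x)\<^sup>2)"
        "bent_cylinder (- e) x = bent_cylinder 0 x + e / 2 * (1 / 16 - (norm x)\<^sup>2)"
        by (simp_all add: bent_cylinder_eq[of e] bent_cylinder_eq[of "- e"] algebra_simps)
      ultimately show False using lower[OF e(1,2)] upper[OF e(1)] e by linarith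
    qed
  qed
  \<comment> \<open>The second axis is the direction of the rulings of the cylinder, where the
    Hessian degenerates; one point suffices.\<close>
  have "0 \<in> S" by (simp add: S_eq)
  then have "axis 2 1 \<bullet> (hessian S (bent_cylinder 0) 0 *v axis 2 1) = 0"
    by (simp add: inner_matrix2_vector axis_def hess)
  moreover have "axis 2 1 \<noteq> (0 :: real^2)" by (simp add: axis_eq_0_iff)
  ultimately have "\<not> strictly_convex \<Omega> (bent_cylinder 0)"
    unfolding strictly_convex_def pos_def_def S_def[symmetric]
    using \<open>0 \<in> S\<close> by (metis less_irrefl)
  then show ?thesis
    using sub sol unique smooth_uniformly_convex_domain_ball[of "1 / 4", folded \<Omega>_def] smooth
    unfolding S_def by (intro exI[of _ \<Omega>] exI[of _ "bent_cylinder 0"] exI[of _ "pi / 4"]) auto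
qed

end
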